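(* Let $\mathcal M_0^+$ be the set of nonnegative measurable processes on $[0,T]$ vanishing at $t=0$. Let $(U^n)_{n\ge0}$ and $(V^n)_{n\ge0}$ be two sequences of processes in $\mathcal M_0^+$. Assume that: (i) almost surely, the series $\sum_{n\ge0}V^n_t$ converges for all $t\in[0,T]$; (ii) the limit of this series is upper bounded by a process $\bar V\in\mathcal M_0^+$, and $\bar V$ is continuous a.s.; (iii) there is a constant $c\ge0$ such that, for every $n\in\mathbb N$, $k\in\mathbb N$ and $t\in[0,T]$, $$\mathbb E\bigl[U^n_{t\wedge\theta_k}\bigr]\le c\,\mathbb E\bigl[V^n_{t\wedge\theta_k}\bigr],$$ with the random time $\theta_k:=\inf\{s\in[0,T]:\bar V_s\ge k\}$. Then for any $t\in[0,T]$, the series $\sum_{n\ge0}U^n_t$ converges almost surely. As a consequence, $U^n_t\to0$ almost surely as $n\to\infty$.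
   Context: $T>0$ is fixed and all processes are real-valued, defined on a filtered probability space $(\Omega,\mathcal F,(\mathcal F_t)_{0\le t\le T},\mathbb P)$ where $(\mathcal F_t)$ is the $\mathbb P$-augmented natural filtration of a $d$-dimensional Brownian motion and $\mathcal F=\mathcal F_T$. Convention: $\inf\varnothing=+\infty$. Expectations of nonnegative random variables take values in $[0,+\infty]$; no integrability is assumed. *)

theory Defs
  imports "HOL-Probability.Probability"
begin

definition natural_filtration ::
    "'a measure \<Rightarrow> (real \<Rightarrow> 'a \<Rightarrow> 'b::topological_space) \<Rightarrow> real \<Rightarrow> 'a measure" where
  "natural_filtration M X t =
     sigma (space M) {X s -` B \<inter> space M | s B. s \<in> {0..t} \<and> B \<in> sets borel}"

text \<open>Augmentation by all subsets of \<open>M\<close>-null events. These subsets need not belong to \<open>M\<close> in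
  general; requiring \<open>sets M = sets (augmented_filtration M X T)\<close> forces \<open>M\<close> to be complete.\<close>

definition augmented_filtration ::
    "'a measure \<Rightarrow> (real \<Rightarrow> 'a \<Rightarrow> 'b::topological_space) \<Rightarrow> real \<Rightarrow> 'a measure" where
  "augmented_filtration M X t =
     sigma (space M) (sets (natural_filtration M X t) \<union> {N. \<exists>A\<in>null_sets M. N \<subseteq> A})"

lemma filtration_augmented_filtration: "filtration (space M) (augmented_filtration M X)"
proof
  fix i j :: real
  have sub: "sets (natural_filtration M X t) \<union> {N. \<exists>A\<in>null_sets M. N \<subseteq> A} \<subseteq> Pow (space M)" for t
  proof -
    have "sets (natural_filtration M X t) \<subseteq> Pow (space M)"
      using sets.sets_into_space[of _ "natural_filtration M X t"]
      by (auto simp: natural_filtration_def space_measure_of_conv)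
    moreover have "{N. \<exists>A\<in>null_sets M. N \<subseteq> A} \<subseteq> Pow (space M)"
      using sets.sets_into_space by (fastforce dest: null_setsD2)
    ultimately show ?thesis by blast
  qed
  show "space (augmented_filtration M X i) = space M"
    by (simp add: augmented_filtration_def space_measure_of_conv)
  assume "i \<le> j"
  have "sets (natural_filtration M X i) \<subseteq> sets (natural_filtration M X j)"
    unfolding natural_filtration_def using \<open>i \<le> j\<close>
    by (subst (1 2) sets_measure_of) (fastforce intro!: sigma_sets_mono')+
  then show "sets (augmented_filtration M X i) \<subseteq> sets (augmented_filtration M X j)"
    unfolding augmented_filtration_def using sub
    by (subst (1 2) sets_measure_of) (auto intro!: sigma_sets_mono')
qed

text \<open>Standard Brownian motion on \<open>{0..T}\<close> with values in \<open>real ^ 'd\<close>: the increment over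
  \<open>s < t\<close> is independent of the past up to \<open>s\<close>, with independent coordinates of law
  \<open>N(0, t - s)\<close>.  The second parameter of \<open>normal_density\<close> is the standard deviation.\<close>

definition brownian_motion_on ::
    "'a measure \<Rightarrow> real \<Rightarrow> (real \<Rightarrow> 'a \<Rightarrow> real ^ 'd::finite) \<Rightarrow> bool" where
  "brownian_motion_on M T W \<longleftrightarrow>
     (\<forall>t\<in>{0..T}. W t \<in> borel_measurable M) \<and>
     (AE \<omega> in M. W 0 \<omega> = 0) \<and>
     (AE \<omega> in M. continuous_on {0..T} (\<lambda>t. W t \<omega>)) \<and>
     (\<forall>s\<in>{0..T}. \<forall>t\<in>{s<..T}.
        prob_space.indep_set M (sets (natural_filtration M W s))
          {(\<lambda>\<omega>. W t \<omega> - W s \<omega>) -` B \<inter> space M | B. B \<in> sets borel} \<and>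
        prob_space.indep_vars M (\<lambda>_. borel) (\<lambda>i \<omega>. (W t \<omega> - W s \<omega>) $ i) UNIV \<and>
        (\<forall>i. distributed M lborel (\<lambda>\<omega>. (W t \<omega> - W s \<omega>) $ i)
               (\<lambda>x. ennreal (normal_density 0 (sqrt (t - s)) x))))"

text \<open>Processes are functions of all real times, of which only the times in \<open>{0..T}\<close> matter;
  a measurable process is one that is jointly measurable in time and outcome.\<close>

definition M0_plus :: "'a measure \<Rightarrow> real \<Rightarrow> (real \<Rightarrow> 'a \<Rightarrow> real) set" where
  "M0_plus M T = {X.
     (\<lambda>(t, \<omega>). X t \<omega>) \<in> borel_measurable (restrict_space borel {0..T} \<Otimes>\<^sub>M M) \<and>
     (\<forall>t\<in>{0..T}. \<forall>\<omega>\<in>space M. 0 \<le> X t \<omega>) \<and>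
     (\<forall>\<omega>\<in>space M. X 0 \<omega> = 0)}"

text \<open>In \<^typ>\<open>ereal\<close> the infimum of the empty set is \<open>\<infinity>\<close>.\<close>

definition hitting_time ::
    "real \<Rightarrow> (real \<Rightarrow> 'a \<Rightarrow> real) \<Rightarrow> nat \<Rightarrow> 'a \<Rightarrow> ereal" where
  "hitting_time T X k \<omega> = (INF s\<in>{s\<in>{0..T}. real k \<le> X s \<omega>}. ereal s)"

text \<open>The random variable \<open>X\<close> at time \<open>t \<and> \<theta>\<close>; the minimum is finite whenever
  \<open>\<theta> \<ge> 0\<close>, so \<open>real_of_ereal\<close> loses nothing.\<close>

definition stopped_value ::
    "(real \<Rightarrow> 'a \<Rightarrow> real) \<Rightarrow> ('a \<Rightarrow> ereal) \<Rightarrow> real \<Rightarrow> 'a \<Rightarrow> real" where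
  "stopped_value X \<theta> t \<omega> = X (real_of_ereal (min (ereal t) (\<theta> \<omega>))) \<omega>"

end

theory Submission imports Defs begin

text \<open>Stopped at \<open>\<theta>\<^sub>k\<close>, the series of the \<open>V\<^sup>n\<close> is at most \<open>k\<close>, so domination and monotone
  convergence bound the expectation of the stopped series of the \<open>U\<^sup>n\<close> by \<open>c k\<close>, which is
  therefore almost surely finite for each \<open>k\<close>. A continuous path of \<open>Vbar\<close> is bounded, so
  \<open>\<theta>\<^sub>k = \<infinity>\<close> for large \<open>k\<close>. Monotone convergence needs the stopped values to be measurable; as
  \<open>Vbar\<close> is continuous only almost surely, this uses the completeness of the measure.\<close>

section \<open>Completeness of the augmented measure\<close>

lemma complete_measure_augmented_filtration:
  assumes "sets M = sets (augmented_filtration M X t)"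
  shows "complete_measure M"
proof
  fix A B assume "B \<subseteq> A" "A \<in> null_sets M"
  moreover have "sets (natural_filtration M X t) \<union> {N. \<exists>A\<in>null_sets M. N \<subseteq> A} \<subseteq> Pow (space M)"
  proof -
    have "sets (natural_filtration M X t) \<subseteq> Pow (space M)"
      using sets.space_closed[of "natural_filtration M X t"]
      by (simp add: natural_filtration_def space_measure_of_conv)
    moreover have "N \<subseteq> space M" if "N \<subseteq> A" "A \<in> null_sets M" for N A
      using that(1) sets.sets_into_space[OF null_setsD2[OF that(2)]] by (rule order_trans)
    ultimately show ?thesis by blast
  qed
  \<comment> \<open>The subset \<open>B\<close> of a null set is itself one of the generators. The
    inclusion in \<open>Pow (space M)\<close> is what makes the sets of \<open>sigma\<close> the
    generated sigma-algebra.\<close>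
  ultimately show "B \<in> sets M"
    unfolding assms augmented_filtration_def by (auto simp: sets_measure_of)
qed

section \<open>Hitting times of continuous paths\<close>

lemma hitting_time_nonneg: "0 \<le> hitting_time T X k \<omega>"
  unfolding hitting_time_def by (auto intro!: INF_greatest)

lemma hitting_time_le:
  assumes "x \<in> {0..T}" "real k \<le> X x \<omega>"
  shows "hitting_time T X k \<omega> \<le> ereal x"
  unfolding hitting_time_def using assms by (auto intro!: INF_lower)

text \<open>The coercion \<open>real_of_ereal\<close> sends both infinities to 0. Neither occurs
  here: the minimum is at most the finite \<open>t\<close>, and hitting times are
  nonnegative.\<close>

lemma real_min_hitting_time:
  assumes "0 \<le> t"
  shows "ereal (real_of_ereal (min (ereal t) (hitting_time T X k \<omega>)))
           = min (ereal t) (hitting_time T X k \<omega>)"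
  using assms hitting_time_nonneg[of T X k \<omega>]
  by (cases "hitting_time T X k \<omega>") (auto simp: min_def)

lemma real_min_hitting_time_bounds:
  assumes "0 \<le> t"
  shows "real_of_ereal (min (ereal t) (hitting_time T X k \<omega>)) \<in> {0..t}"
  using assms hitting_time_nonneg[of T X k \<omega>]
  by (cases "hitting_time T X k \<omega>") (auto simp: min_def)

text \<open>Continuity makes the set of times with value at least \<open>k\<close> compact, so its
  infimum is attained. A path that only jumps above \<open>k\<close> just after \<open>s\<close>
  would violate the equivalence.\<close>

lemma hitting_time_le_iff:
  assumes cont: "continuous_on {0..T} (\<lambda>t. X t \<omega>)" and s: "s \<in> {0..T}"
  shows "hitting_time T X k \<omega> \<le> ereal s \<longleftrightarrow> (\<exists>x\<in>{0..s}. real k \<le> X x \<omega>)"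
proof
  assume le: "hitting_time T X k \<omega> \<le> ereal s"
  define S where "S = {x\<in>{0..T}. real k \<le> X x \<omega>}"
  have hit: "hitting_time T X k \<omega> = (INF x\<in>S. ereal x)"
    unfolding hitting_time_def S_def ..
  have "S \<noteq> {}"
    using le unfolding hit by (auto simp: top_ereal_def)
  moreover have "compact S"
  proof -
    have "closed S"
      unfolding S_def by (intro continuous_on_closed_Collect_le cont) auto
    moreover have "bounded S"
      by (rule bounded_subset[of "{0..T}"]) (auto simp: S_def)
    ultimately show ?thesis
      by (simp add: compact_eq_bounded_closed)
  qed
  ultimately obtain x where x: "x \<in> S" "\<forall>y\<in>S. x \<le> y"
    using compact_attains_inf[of S] by blast
  then have "ereal x \<le> ereal s"
    using le unfolding hit by (meson INF_greatest ereal_less_eq(3) order_trans)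
  then show "\<exists>x\<in>{0..s}. real k \<le> X x \<omega>"
    using x by (auto simp: S_def)
next
  assume "\<exists>x\<in>{0..s}. real k \<le> X x \<omega>"
  then obtain x where x: "x \<in> {0..s}" "real k \<le> X x \<omega>" by blast
  then have "hitting_time T X k \<omega> \<le> ereal x"
    using s by (intro hitting_time_le) auto
  then show "hitting_time T X k \<omega> \<le> ereal s"
    using x by (meson atLeastAtMost_iff ereal_less_eq(3) order_trans)
qed

text \<open>This trades an existential over an interval for countable operations. Rational times
  only approximate a point where \<open>f\<close> reaches \<open>a\<close>, hence the slack
  \<open>1 / real (Suc j)\<close>; conversely, values arbitrarily close to \<open>a\<close> force
  the attained maximum up to \<open>a\<close>.\<close>

lemma continuous_attains_ge_iff_rational:
  fixes f :: "real \<Rightarrow> real"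
  assumes cont: "continuous_on {0..s} f" and s: "0 \<le> s"
  shows "(\<exists>x\<in>{0..s}. a \<le> f x) \<longleftrightarrow> (\<forall>j. \<exists>q\<in>\<rat> \<inter> {0..s}. a - 1 / real (Suc j) < f q)"
proof
  assume "\<exists>x\<in>{0..s}. a \<le> f x"
  then obtain x where x: "x \<in> {0..s}" "a \<le> f x" by blast
  show "\<forall>j. \<exists>q\<in>\<rat> \<inter> {0..s}. a - 1 / real (Suc j) < f q"
  proof
    fix j
    have e: "0 < 1 / real (Suc j)" by simp
    obtain d where d: "d > 0" "\<And>y. y \<in> {0..s} \<Longrightarrow> dist y x < d \<Longrightarrow> dist (f y) (f x) < 1 / real (Suc j)"
      using cont x(1) e unfolding continuous_on_iff by meson
    have "\<exists>q\<in>\<rat> \<inter> {0..s}. dist q x < d"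
    \<comment> \<open>A one-point interval contains no open interval in which to find a rational,
      but its point 0 is rational.\<close>
    proof (cases "s = 0")
      case True
      then show ?thesis using x d(1) by (intro bexI[of _ 0]) auto
    next
      case False
      then have "max 0 (x - d) < min s (x + d)"
        using s x d(1) by auto
      then obtain q where "q \<in> \<rat>" "max 0 (x - d) < q" "q < min s (x + d)"
        using Rats_dense_in_real by blast
      then show ?thesis by (intro bexI[of _ q]) (auto simp: dist_real_def)
    qed
    then obtain q where q: "q \<in> \<rat> \<inter> {0..s}" "dist q x < d" by blast
    then have "\<bar>f q - f x\<bar> < 1 / real (Suc j)"
      using d(2)[of q] by (simp add: dist_real_def)
    then have "a - 1 / real (Suc j) < f q" using x(2) by linarith
    then show "\<exists>q\<in>\<rat> \<inter> {0..s}. a - 1 / real (Suc j) < f q" using q(1) by blast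
  qed
next
  assume near: "\<forall>j. \<exists>q\<in>\<rat> \<inter> {0..s}. a - 1 / real (Suc j) < f q"
  obtain x where x: "x \<in> {0..s}" "\<forall>y\<in>{0..s}. f y \<le> f x"
    using continuous_attains_sup[OF _ _ cont] s by auto
  have "a \<le> f x"
  proof (rule ccontr)
    assume "\<not> a \<le> f x"
    then obtain j where j: "1 / real (Suc j) < a - f x"
      using nat_approx_posE[of "a - f x"] by auto
    obtain q where "q \<in> \<rat> \<inter> {0..s}" "a - 1 / real (Suc j) < f q"
      using near by blast
    with j x(2) show False by force
  qed
  with x(1) show "\<exists>x\<in>{0..s}. a \<le> f x" by blast
qed

section \<open>Measurability at random times\<close>

lemma M0_plus_measurable_at:
  assumes X: "X \<in> M0_plus M T" and "\<tau> \<in> borel_measurable M" "\<tau> \<in> space M \<rightarrow> {0..T}"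
  shows "(\<lambda>\<omega>. X (\<tau> \<omega>) \<omega>) \<in> borel_measurable M"
proof -
  \<comment> \<open>Joint measurability of the process allows composition with the graph map of
    \<open>\<tau>\<close>.\<close>
  have "(\<lambda>\<omega>. (\<tau> \<omega>, \<omega>)) \<in> M \<rightarrow>\<^sub>M restrict_space borel {0..T} \<Otimes>\<^sub>M M"
    using assms(2,3) by (intro measurable_Pair measurable_restrict_space2) auto
  moreover have "(\<lambda>(t, \<omega>). X t \<omega>) \<in> borel_measurable (restrict_space borel {0..T} \<Otimes>\<^sub>M M)"
    using X by (simp add: M0_plus_def)
  ultimately have "(\<lambda>\<omega>. (\<lambda>(t, \<omega>). X t \<omega>) (\<tau> \<omega>, \<omega>)) \<in> borel_measurable M"
    by (rule measurable_compose)
  then show ?thesis by simp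
qed

lemma M0_plus_nonneg: "X \<in> M0_plus M T \<Longrightarrow> t \<in> {0..T} \<Longrightarrow> \<omega> \<in> space M \<Longrightarrow> 0 \<le> X t \<omega>"
  by (simp add: M0_plus_def)

lemma (in complete_measure) measurable_min_hitting_time:
  assumes X: "X \<in> M0_plus M T" and cont: "AE \<omega> in M. continuous_on {0..T} (\<lambda>t. X t \<omega>)"
    and t: "t \<in> {0..T}"
  shows "(\<lambda>\<omega>. real_of_ereal (min (ereal t) (hitting_time T X k \<omega>))) \<in> borel_measurable M"
  unfolding borel_measurable_iff_le
proof
  fix s
  define \<tau> where "\<tau> = (\<lambda>\<omega>. real_of_ereal (min (ereal t) (hitting_time T X k \<omega>)))"
  have \<tau>: "\<tau> \<omega> \<in> {0..t}" "ereal (\<tau> \<omega>) = min (ereal t) (hitting_time T X k \<omega>)" for \<omega>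
    using t real_min_hitting_time_bounds[of t T X k \<omega>] real_min_hitting_time[of t T X k \<omega>]
    by (auto simp: \<tau>_def)
  have "{\<omega> \<in> space M. \<tau> \<omega> \<le> s} \<in> sets M"
  proof (cases "0 \<le> s \<and> s < t")
    \<comment> \<open>Since \<open>\<tau>\<close> takes values in \<open>{0..t}\<close>, the
      sublevel set is empty for \<open>s < 0\<close> and the whole space for
      \<open>s \<ge> t\<close>.\<close>
    case False
    then have "{\<omega> \<in> space M. \<tau> \<omega> \<le> s} = {} \<or> {\<omega> \<in> space M. \<tau> \<omega> \<le> s} = space M"
      using \<tau>(1) by (smt (verit) Collect_cong Collect_empty_eq Collect_mem_eq atLeastAtMost_iff)
    then show ?thesis by (metis sets.empty_sets sets.top)
  next
    case True
    then have s: "s \<in> {0..T}" using t by auto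
    define A where
      "A = {\<omega> \<in> space M. \<forall>j. \<exists>q\<in>\<rat> \<inter> {0..s}. real k - 1 / real (Suc j) < X q \<omega>}"
    have meas: "X q \<in> borel_measurable M" if "q \<in> \<rat> \<inter> {0..s}" for q
      using M0_plus_measurable_at[OF X, of "\<lambda>_. q"] that s by auto
    have "A = (\<Inter>j. \<Union>q\<in>\<rat> \<inter> {0..s}. {\<omega> \<in> space M. real k - 1 / real (Suc j) < X q \<omega>})"
      by (auto simp: A_def)
    also have "\<dots> \<in> sets M"
    proof (intro sets.countable_INT image_subsetI sets.countable_UN'')
      show "countable (\<rat> \<inter> {0..s})"
        by (simp add: countable_rat countable_Int1)
      fix j q assume "q \<in> \<rat> \<inter> {0..s}"
      then show "{\<omega> \<in> space M. real k - 1 / real (Suc j) < X q \<omega>} \<in> sets M"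
        using meas borel_measurable_iff_greater by blast
    qed simp
    finally have A: "A \<in> sets M" .
    have "AE \<omega> in M. \<omega> \<in> A \<longleftrightarrow> \<omega> \<in> {\<omega> \<in> space M. \<tau> \<omega> \<le> s}"
      using cont AE_space
    proof eventually_elim
      case (elim \<omega>)
      \<comment> \<open>As \<open>s < t\<close>, the truncation at \<open>t\<close> cannot be what
        brings the minimum down to \<open>s\<close>.\<close>
      have "\<tau> \<omega> \<le> s \<longleftrightarrow> hitting_time T X k \<omega> \<le> ereal s"
        using True \<tau>(2)[of \<omega>] by (cases "hitting_time T X k \<omega>") (auto simp: min_def split: if_splits)
      also have "\<dots> \<longleftrightarrow> (\<exists>x\<in>{0..s}. real k \<le> X x \<omega>)"
        by (intro hitting_time_le_iff elim(1) s)
      also have "\<dots> \<longleftrightarrow> \<omega> \<in> A"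
      proof (subst continuous_attains_ge_iff_rational)
        show "continuous_on {0..s} (\<lambda>t. X t \<omega>)"
          by (rule continuous_on_subset[OF elim(1)]) (use s in auto)
      qed (use s elim(2) in \<open>simp_all add: A_def\<close>)
      finally show ?case using elim by simp
    qed
    \<comment> \<open>Completeness enters here: the sublevel set agrees with the measurable set
      \<open>A\<close> only outside a null set, where paths may be discontinuous.\<close>
    from in_sets_AE[OF this A] show ?thesis by blast
  qed
  then show "{\<omega> \<in> space M. real_of_ereal (min (ereal t) (hitting_time T X k \<omega>)) \<le> s} \<in> sets M"
    by (simp add: \<tau>_def)
qed

section \<open>Effect of stopping on a path\<close>

lemma stopped_at_hitting_time_le:
  assumes cont: "continuous_on {0..T} (\<lambda>t. X t \<omega>)" and "X 0 \<omega> \<le> real k" and t: "t \<in> {0..T}"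
  shows "stopped_value X (hitting_time T X k) t \<omega> \<le> real k"
proof (rule ccontr)
  define s where "s = real_of_ereal (min (ereal t) (hitting_time T X k \<omega>))"
  assume "\<not> stopped_value X (hitting_time T X k) t \<omega> \<le> real k"
  then have gt: "real k < X s \<omega>" by (simp add: stopped_value_def s_def)
  have s: "s \<in> {0..t}" "ereal s \<le> hitting_time T X k \<omega>"
    using t real_min_hitting_time_bounds[of t T X k \<omega>] real_min_hitting_time[of t T X k \<omega>]
    by (auto simp: s_def min_def split: if_splits)
  have "continuous_on {0..s} (\<lambda>t. X t \<omega>)"
    using s t by (intro continuous_on_subset[OF cont]) auto
  \<comment> \<open>The path starts at or below \<open>k\<close> and exceeds it at \<open>s\<close>,
    so it takes the value \<open>k\<close> at some \<open>x \<le> s\<close>. The hitting time is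
    then at most \<open>x\<close>, while \<open>s\<close> is at most the hitting time; this forces
    \<open>x = s\<close>, where the value is strictly above \<open>k\<close>.\<close>
  then obtain x where x: "0 \<le> x" "x \<le> s" "X x \<omega> = real k"
    using IVT'[of "\<lambda>t. X t \<omega>" 0 "real k" s] assms(2) gt s(1) by auto
  then have "hitting_time T X k \<omega> \<le> ereal x"
    using s t by (intro hitting_time_le) auto
  with s(2) have "s \<le> x" by (metis ereal_less_eq(3) order_trans)
  with x gt show False by auto
qed

text \<open>Any \<open>k\<close> above the maximum of the path leaves the hitting set empty. The
  level depends on \<open>\<omega>\<close> but not on \<open>Y\<close>, so one \<open>k\<close>
  undoes the stopping in all terms of a series at once.\<close>

lemma ex_stopped_value_hitting_time_eq:
  assumes cont: "continuous_on {0..T} (\<lambda>t. X t \<omega>)" and "0 \<le> T"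
  shows "\<exists>k. \<forall>Y t. stopped_value Y (hitting_time T X k) t \<omega> = Y t \<omega>"
proof -
  obtain x where x: "\<forall>y\<in>{0..T}. X y \<omega> \<le> X x \<omega>"
    using continuous_attains_sup[OF _ _ cont] \<open>0 \<le> T\<close> by auto
  obtain k where "X x \<omega> < real k"
    using reals_Archimedean2 by blast
  then have "{s\<in>{0..T}. real k \<le> X s \<omega>} = {}"
    using x by fastforce
  then have "hitting_time T X k \<omega> = \<infinity>"
    unfolding hitting_time_def by (simp only: image_empty Inf_empty top_ereal_def)
  then show ?thesis
    by (intro exI[of _ k]) (simp add: stopped_value_def)
qed

section \<open>Almost sure summability from domination in expectation\<close>

lemma (in prob_space) AE_summable_of_dominated:
  fixes u v :: "nat \<Rightarrow> 'a \<Rightarrow> real"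
  assumes [measurable]: "\<And>n. u n \<in> borel_measurable M" "\<And>n. v n \<in> borel_measurable M"
    and u: "\<And>n \<omega>. \<omega> \<in> space M \<Longrightarrow> 0 \<le> u n \<omega>" and v: "\<And>n \<omega>. \<omega> \<in> space M \<Longrightarrow> 0 \<le> v n \<omega>"
    and v_sum: "AE \<omega> in M. summable (\<lambda>n. v n \<omega>) \<and> (\<Sum>n. v n \<omega>) \<le> K"
    and dom: "\<And>n. (\<integral>\<^sup>+\<omega>. ennreal (u n \<omega>) \<partial>M) \<le> ennreal c * (\<integral>\<^sup>+\<omega>. ennreal (v n \<omega>) \<partial>M)"
  shows "AE \<omega> in M. summable (\<lambda>n. u n \<omega>)"
proof -
  \<comment> \<open>Sum and integral are exchanged in \<open>ennreal\<close>, where neither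
    convergence nor integrability has to be known beforehand.\<close>
  have "(\<integral>\<^sup>+\<omega>. (\<Sum>n. ennreal (u n \<omega>)) \<partial>M) = (\<Sum>n. \<integral>\<^sup>+\<omega>. ennreal (u n \<omega>) \<partial>M)"
    by (rule nn_integral_suminf) simp
  also have "\<dots> \<le> (\<Sum>n. ennreal c * (\<integral>\<^sup>+\<omega>. ennreal (v n \<omega>) \<partial>M))"
    by (intro suminf_le dom) auto
  also have "\<dots> = ennreal c * (\<integral>\<^sup>+\<omega>. (\<Sum>n. ennreal (v n \<omega>)) \<partial>M)"
    by (simp add: nn_integral_suminf)
  also have "(\<integral>\<^sup>+\<omega>. (\<Sum>n. ennreal (v n \<omega>)) \<partial>M) \<le> (\<integral>\<^sup>+\<omega>. ennreal K \<partial>M)"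
  proof (rule nn_integral_mono_AE)
    show "AE \<omega> in M. (\<Sum>n. ennreal (v n \<omega>)) \<le> ennreal K"
      using v_sum AE_space
    proof eventually_elim
      case (elim \<omega>)
      \<comment> \<open>Summability is essential: without it the extended sum is infinite and the
        real \<open>suminf\<close> carries no information.\<close>
      then have "(\<Sum>n. ennreal (v n \<omega>)) = ennreal (\<Sum>n. v n \<omega>)"
        using v by (intro suminf_ennreal2) auto
      then show ?case using elim by (simp add: ennreal_leI)
    qed
  qed
  also have "(\<integral>\<^sup>+\<omega>. ennreal K \<partial>M) = ennreal K"
    by (simp add: emeasure_space_1)
  finally have "(\<integral>\<^sup>+\<omega>. (\<Sum>n. ennreal (u n \<omega>)) \<partial>M) \<le> ennreal c * ennreal K"
    by (simp add: mult_left_mono)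
  then have "(\<integral>\<^sup>+\<omega>. (\<Sum>n. ennreal (u n \<omega>)) \<partial>M) \<noteq> \<infinity>"
    by (auto simp: ennreal_mult_eq_top_iff top_unique)
  then have "AE \<omega> in M. (\<Sum>n. ennreal (u n \<omega>)) \<noteq> \<infinity>"
    by (intro nn_integral_PInf_AE) auto
  then show ?thesis
    using AE_space
  proof eventually_elim
    case (elim \<omega>)
    then show ?case using u by (intro summable_suminf_not_top) auto
  qed
qed

section \<open>From the stopped series to the series itself\<close>

theorem lemma2p1:
  fixes M :: "'a measure" and T c :: real
    and W :: "real \<Rightarrow> 'a \<Rightarrow> real ^ 'd::finite"
    and F :: "real \<Rightarrow> 'a measure"
    and U V :: "nat \<Rightarrow> real \<Rightarrow> 'a \<Rightarrow> real"
    and Vbar :: "real \<Rightarrow> 'a \<Rightarrow> real"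
  assumes T_pos: "0 < T"
    and M: "prob_space M"
    and W: "brownian_motion_on M T W"
    and F: "\<And>t. t \<in> {0..T} \<Longrightarrow> F t = augmented_filtration M W t"
    and sets_M: "sets M = sets (F T)"
    and U: "\<And>n. U n \<in> M0_plus M T"
    and V: "\<And>n. V n \<in> M0_plus M T"
    and V_summable: "AE \<omega> in M. \<forall>t\<in>{0..T}. summable (\<lambda>n. V n t \<omega>)"
    and Vbar: "Vbar \<in> M0_plus M T"
    and V_le_Vbar: "AE \<omega> in M. \<forall>t\<in>{0..T}. (\<Sum>n. V n t \<omega>) \<le> Vbar t \<omega>"
    and Vbar_cont: "AE \<omega> in M. continuous_on {0..T} (\<lambda>t. Vbar t \<omega>)"
    and c: "0 \<le> c"
    and domination: "\<And>n k t. t \<in> {0..T} \<Longrightarrow>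
          (\<integral>\<^sup>+ \<omega>. ennreal (stopped_value (U n) (hitting_time T Vbar k) t \<omega>) \<partial>M)
          \<le> ennreal c * (\<integral>\<^sup>+ \<omega>. ennreal (stopped_value (V n) (hitting_time T Vbar k) t \<omega>) \<partial>M)"
  shows "\<forall>t\<in>{0..T}. (AE \<omega> in M. summable (\<lambda>n. U n t \<omega>)) \<and>
                     (AE \<omega> in M. (\<lambda>n. U n t \<omega>) \<longlonglongrightarrow> 0)"
proof -
  interpret prob_space M by (rule M)
  interpret complete_measure M
    using complete_measure_augmented_filtration[of M W T] sets_M F[of T] T_pos by simp
  define \<theta> where "\<theta> = hitting_time T Vbar"
  have bounds: "real_of_ereal (min (ereal t) (\<theta> k \<omega>)) \<in> {0..T}" if "t \<in> {0..T}" for t k \<omega>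
    using real_min_hitting_time_bounds[of t T Vbar k \<omega>] that by (auto simp: \<theta>_def)
  have stopped_measurable: "stopped_value X (\<theta> k) t \<in> borel_measurable M"
    if "X \<in> M0_plus M T" "t \<in> {0..T}" for X k t
    using M0_plus_measurable_at[OF that(1) measurable_min_hitting_time[OF Vbar Vbar_cont that(2)]]
      bounds[OF that(2)]
    unfolding stopped_value_def \<theta>_def by auto
  have stopped_nonneg: "0 \<le> stopped_value X (\<theta> k) t \<omega>"
    if "X \<in> M0_plus M T" "t \<in> {0..T}" "\<omega> \<in> space M" for X k t \<omega>
    unfolding stopped_value_def using that bounds M0_plus_nonneg by metis
  have stopped_summable: "AE \<omega> in M. summable (\<lambda>n. stopped_value (U n) (\<theta> k) t \<omega>)"
    if t: "t \<in> {0..T}" for k t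
  proof (rule AE_summable_of_dominated)
    show "AE \<omega> in M. summable (\<lambda>n. stopped_value (V n) (\<theta> k) t \<omega>) \<and>
                      (\<Sum>n. stopped_value (V n) (\<theta> k) t \<omega>) \<le> real k"
      \<comment> \<open>The hypotheses on \<open>V\<close> hold for all times off a single null set,
        so they may be evaluated at the random time given by \<open>t\<close> and
        \<open>\<theta> k\<close>.\<close>
      using V_summable V_le_Vbar Vbar_cont AE_space
    proof eventually_elim
      case (elim \<omega>)
      have "Vbar 0 \<omega> \<le> real k" using Vbar elim(4) by (simp add: M0_plus_def)
      then have "stopped_value Vbar (\<theta> k) t \<omega> \<le> real k"
        unfolding \<theta>_def by (intro stopped_at_hitting_time_le elim(3) t)
      moreover have "(\<Sum>n. stopped_value (V n) (\<theta> k) t \<omega>) \<le> stopped_value Vbar (\<theta> k) t \<omega>"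
        using elim(2) bounds[OF t] unfolding stopped_value_def by blast
      moreover have "summable (\<lambda>n. stopped_value (V n) (\<theta> k) t \<omega>)"
        using elim(1) bounds[OF t] unfolding stopped_value_def by blast
      ultimately show ?case by simp
    qed
    show "(\<integral>\<^sup>+\<omega>. ennreal (stopped_value (U n) (\<theta> k) t \<omega>) \<partial>M)
            \<le> ennreal c * (\<integral>\<^sup>+\<omega>. ennreal (stopped_value (V n) (\<theta> k) t \<omega>) \<partial>M)" for n
      unfolding \<theta>_def by (rule domination[OF t])
  qed (fact stopped_measurable[OF U t] stopped_measurable[OF V t]
      stopped_nonneg[OF U t] stopped_nonneg[OF V t])+
  have summable_U: "AE \<omega> in M. summable (\<lambda>n. U n t \<omega>)" if t: "t \<in> {0..T}" for t
  proof -
    \<comment> \<open>The level that undoes the stopping varies with \<open>\<omega>\<close>, so the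
      exceptional sets of the countably many levels are merged before it is chosen.\<close>
    have "AE \<omega> in M. \<forall>k. summable (\<lambda>n. stopped_value (U n) (\<theta> k) t \<omega>)"
      using stopped_summable[OF t] by (simp add: AE_all_countable)
    then show ?thesis
      using Vbar_cont
    proof eventually_elim
      case (elim \<omega>)
      obtain k where eq: "\<And>Y t. stopped_value Y (\<theta> k) t \<omega> = Y t \<omega>"
        using ex_stopped_value_hitting_time_eq[of T Vbar \<omega>] elim(2) T_pos
        unfolding \<theta>_def by auto
      show ?case using elim(1)[rule_format, of k] by (simp add: eq)
    qed
  qed
  show ?thesis
  proof (intro ballI conjI)
    fix t assume t: "t \<in> {0..T}"
    show "AE \<omega> in M. summable (\<lambda>n. U n t \<omega>)" by (rule summable_U[OF t])
    then show "AE \<omega> in M. (\<lambda>n. U n t \<omega>) \<longlonglongrightarrow> 0"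
      by (rule eventually_mono) (rule summable_LIMSEQ_zero)
  qed
qed

end
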